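(* The set $\mathfrak I_c$ of one-component inner functions is open inside the set of all inner functions, with respect to the topology of the uniform norm $\|f\|=\sup_{z\in\mathbb D}|f(z)|$.
   Context: $\mathbb D$ is the open unit disk. An inner function $u$ on $\mathbb D$ is a one-component inner function if there is $\eta\in\,]0,1[$ such that the level set $\Omega_u(\eta)=\{z\in\mathbb D:|u(z)|<\eta\}$ is connected; $\mathfrak I_c$ is the set of all one-component inner functions. *)

theory Defs
  imports "HOL-Complex_Analysis.Complex_Analysis"
begin

abbreviation unit_disc :: "complex set" where
  "unit_disc \<equiv> ball 0 1"

text \<open>Unimodular constants count as inner functions.\<close>

definition inner_function :: "(complex \<Rightarrow> complex) \<Rightarrow> bool" where
  "inner_function u \<longleftrightarrow>
     u holomorphic_on unit_disc \<and> bounded (u ` unit_disc) \<and>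
     (AE t in lebesgue_on {0..2*pi}.
        \<exists>l. ((\<lambda>r. u (of_real r * cis t)) \<longlongrightarrow> l) (at_left (1::real)) \<and> cmod l = 1)"

definition level_set :: "(complex \<Rightarrow> complex) \<Rightarrow> real \<Rightarrow> complex set" where
  "level_set u \<eta> = {z \<in> unit_disc. cmod (u z) < \<eta>}"

text \<open>For a unimodular constant the level sets are empty, and \<^const>\<open>connected\<close> holds of
  the empty set.\<close>

definition one_component :: "(complex \<Rightarrow> complex) \<Rightarrow> bool" where
  "one_component u \<longleftrightarrow> (\<exists>\<eta>. 0 < \<eta> \<and> \<eta> < 1 \<and> connected (level_set u \<eta>))"

text \<open>A function on the disc is represented by the total function that is \<^const>\<open>undefined\<close>
  outside it, so that equality of representatives is equality on the disc.\<close>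

definition inner_functions :: "(complex \<Rightarrow> complex) set" where
  "inner_functions = {u \<in> extensional unit_disc. inner_function u}"

definition one_component_inner_functions :: "(complex \<Rightarrow> complex) set" where
  "one_component_inner_functions = {u \<in> inner_functions. one_component u}"

abbreviation bounded_functions :: "(complex \<Rightarrow> complex) metric" where
  "bounded_functions \<equiv> funspace unit_disc euclidean_metric"

text \<open>The metric of \<^const>\<open>funspace\<close> is the uniform distance, and restricting its topology
  to the inner functions discards none of them.\<close>

lemma mspace_bounded_functions:
  "mspace bounded_functions = {f \<in> extensional unit_disc. bounded (f ` unit_disc)}"
  by (auto simp: Met_TC.fspace_def)

lemma inner_functions_subset: "inner_functions \<subseteq> mspace bounded_functions"
  unfolding mspace_bounded_functions inner_functions_def inner_function_def by auto

lemma mdist_bounded_functions: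
  assumes "f \<in> mspace bounded_functions" "g \<in> mspace bounded_functions"
  shows "mdist bounded_functions f g = (SUP z\<in>unit_disc. cmod (f z - g z))"
  using assms by (simp add: Met_TC.fdist_def dist_norm)

end

theory Submission
  imports Defs
begin

text \<open>
  The point is that no component of a level set \<open>{\<bar>v\<bar> < \<eta>}\<close> of an inner function, \<open>\<eta> < 1\<close>, is
  shallow: \<open>\<bar>v\<bar>\<close> takes arbitrarily small values on each of them (\<open>component_level_set_deep\<close>).
  Suppose now that \<open>{\<bar>u\<bar> < \<eta>}\<close> is connected and \<open>\<bar>u - v\<bar> < \<epsilon>\<close> on the disc, where \<open>\<epsilon> < \<eta>\<close> and
  \<open>\<eta> + \<epsilon> < 1\<close>.  Then
  \<open>{\<bar>v\<bar> < \<eta> - \<epsilon>} \<subseteq> {\<bar>u\<bar> < \<eta>} \<subseteq> {\<bar>v\<bar> < \<eta> + \<epsilon>}\<close>.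
  Every component of the last set meets the first one, hence the connected set in the middle,
  so there is at most one component.  The radius \<open>\<epsilon>\<close> depends on \<open>\<eta>\<close> only.

  That components are deep is a maximum principle which ignores a null set of the unit circle.  If
  \<open>\<bar>v\<bar>\<close> stays away from \<open>0\<close> on a component, then \<open>1 / \<bar>v\<bar> - 1 / \<eta>\<close>, extended by \<open>0\<close>, is a bounded
  nonnegative subharmonic function with radial limits \<open>0\<close> almost everywhere.  Its means over the
  circles about \<open>0\<close> increase with the radius (\<open>circle_integral_mono\<close>) and tend to \<open>0\<close> by
  dominated convergence, so it is \<open>0\<close>.

  The monotonicity of the means is proved without the Poisson integral: the average of a subharmonic
  function over \<open>n\<close> equally spaced rotations obeys the maximum principle, and on a
  given circle it is uniformly close to the mean when \<open>n\<close> is large.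
\<close>

section \<open>Functions with holomorphic minorants\<close>

text \<open>
  This is a form of subharmonicity: near each point the function has a harmonic minorant that touches
  it there.  Unlike a mean value inequality it passes to sums and rotations without integration,
  and it is visible at once for \<open>\<bar>f\<bar>\<close> with \<open>f\<close> holomorphic, where the real part of a
  unimodular multiple of \<open>f\<close> serves as minorant.
\<close>

definition holomorphic_minorants_on :: "(complex \<Rightarrow> real) \<Rightarrow> complex set \<Rightarrow> bool" where
  "holomorphic_minorants_on h S \<longleftrightarrow>
     (\<forall>a\<in>S. \<exists>e>0. \<exists>F. F holomorphic_on ball a e \<and> ball a e \<subseteq> S \<and>
        Re (F a) = h a \<and> (\<forall>z\<in>ball a e. Re (F z) \<le> h z))"

lemma holomorphic_minorants_onE:
  assumes "holomorphic_minorants_on h S" "a \<in> S"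
  obtains e F where "e > 0" "F holomorphic_on ball a e" "ball a e \<subseteq> S" "Re (F a) = h a"
    "\<And>z. z \<in> ball a e \<Longrightarrow> Re (F z) \<le> h z"
  using assms unfolding holomorphic_minorants_on_def by blast

lemma holomorphic_minorants_on_open_subset:
  assumes "holomorphic_minorants_on h S" "open T" "T \<subseteq> S"
  shows "holomorphic_minorants_on h T"
  unfolding holomorphic_minorants_on_def
proof
  fix a assume "a \<in> T"
  then have "a \<in> S"
    using assms(3) by blast
  then obtain e F where F: "e > 0" "F holomorphic_on ball a e" "ball a e \<subseteq> S" "Re (F a) = h a"
    "\<And>z. z \<in> ball a e \<Longrightarrow> Re (F z) \<le> h z"
    by (rule holomorphic_minorants_onE[OF assms(1)]) (rule that)
  obtain e' where "e' > 0" "ball a e' \<subseteq> T"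
    using \<open>a \<in> T\<close> \<open>open T\<close> openE by blast
  then show "\<exists>e>0. \<exists>F. F holomorphic_on ball a e \<and> ball a e \<subseteq> T \<and>
        Re (F a) = h a \<and> (\<forall>z\<in>ball a e. Re (F z) \<le> h z)"
    using F by (intro exI[of _ "min e e'"] conjI exI[of _ F])
      (auto intro: holomorphic_on_subset)
qed

lemma holomorphic_minorants_on_add:
  assumes "holomorphic_minorants_on g S" "holomorphic_minorants_on h S"
  shows "holomorphic_minorants_on (\<lambda>z. g z + h z) S"
  unfolding holomorphic_minorants_on_def
proof
  fix a assume a: "a \<in> S"
  obtain e F where F: "e > 0" "F holomorphic_on ball a e" "ball a e \<subseteq> S" "Re (F a) = g a"
    "\<And>z. z \<in> ball a e \<Longrightarrow> Re (F z) \<le> g z"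
    by (rule holomorphic_minorants_onE[OF assms(1) a]) (rule that)
  obtain e' G where G: "e' > 0" "G holomorphic_on ball a e'" "ball a e' \<subseteq> S" "Re (G a) = h a"
    "\<And>z. z \<in> ball a e' \<Longrightarrow> Re (G z) \<le> h z"
    by (rule holomorphic_minorants_onE[OF assms(2) a]) (rule that)
  have "(\<lambda>z. F z + G z) holomorphic_on ball a (min e e')"
    using F(2) G(2) by (intro holomorphic_on_add) (auto elim: holomorphic_on_subset)
  then show "\<exists>e>0. \<exists>F. F holomorphic_on ball a e \<and> ball a e \<subseteq> S \<and>
        Re (F a) = g a + h a \<and> (\<forall>z\<in>ball a e. Re (F z) \<le> g z + h z)"
    using F G by (intro exI[of _ "min e e'"] conjI exI[of _ "\<lambda>z. F z + G z"])
      (auto intro!: add_mono)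
qed

lemma holomorphic_minorants_on_sum:
  fixes n :: nat
  assumes "open S" "\<And>k. k < n \<Longrightarrow> holomorphic_minorants_on (h k) S"
  shows "holomorphic_minorants_on (\<lambda>z. \<Sum>k<n. h k z) S"
  using assms(2)
proof (induction n)
  case 0
  have "\<exists>e>0. \<exists>F. F holomorphic_on ball a e \<and> ball a e \<subseteq> S \<and>
        Re (F a) = 0 \<and> (\<forall>z\<in>ball a e. Re (F z) \<le> 0)" if a: "a \<in> S" for a
  proof -
    obtain e where "e > 0" "ball a e \<subseteq> S"
      using a \<open>open S\<close> openE by blast
    then show ?thesis
      by (intro exI[of _ e] conjI exI[of _ "\<lambda>_. 0"]) auto
  qed
  then show ?case
    by (simp add: holomorphic_minorants_on_def)
next
  case (Suc n)
  then show ?case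
    by (auto intro: holomorphic_minorants_on_add)
qed

lemma holomorphic_minorants_on_rotate:
  assumes h: "holomorphic_minorants_on h (ball 0 r)" and c: "cmod c = 1"
  shows "holomorphic_minorants_on (\<lambda>z. h (z * c)) (ball 0 r)"
  unfolding holomorphic_minorants_on_def
proof
  fix a :: complex assume "a \<in> ball 0 r"
  then have "a * c \<in> ball 0 r"
    using c by (simp add: norm_mult)
  then obtain e F where F: "e > 0" "F holomorphic_on ball (a * c) e" "ball (a * c) e \<subseteq> ball 0 r"
    "Re (F (a * c)) = h (a * c)" "\<And>z. z \<in> ball (a * c) e \<Longrightarrow> Re (F z) \<le> h z"
    by (rule holomorphic_minorants_onE[OF h]) (rule that)
  have dist: "z * c \<in> ball (a * c) e" if "z \<in> ball a e" for z
    using that c by (simp add: dist_norm norm_mult flip: left_diff_distrib)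
  have "ball a e \<subseteq> ball 0 r"
  proof
    fix z assume "z \<in> ball a e"
    then have "z * c \<in> ball 0 r"
      using dist F(3) by blast
    then show "z \<in> ball 0 r"
      using c by (simp add: norm_mult)
  qed
  moreover have "(F \<circ> (\<lambda>z. z * c)) holomorphic_on ball a e"
    using dist by (intro holomorphic_on_compose_gen[OF _ F(2)] holomorphic_intros) auto
  ultimately show "\<exists>e>0. \<exists>F. F holomorphic_on ball a e \<and> ball a e \<subseteq> ball 0 r \<and>
        Re (F a) = h (a * c) \<and> (\<forall>z\<in>ball a e. Re (F z) \<le> h (z * c))"
    using F dist by (intro exI[of _ e] conjI exI[of _ "F \<circ> (\<lambda>z. z * c)"]) auto
qed

text \<open>
  At a maximum point \<open>a\<close> inside the disc the minorant \<open>F\<close> satisfies \<open>Re F \<le> Re (F a)\<close>, so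
  \<open>exp F\<close> is constant by the maximum modulus principle and \<open>h\<close> is maximal on a whole
  neighbourhood of \<open>a\<close>.  Hence a maximum point of largest modulus lies on the circle.
\<close>

lemma holomorphic_minorants_maximum_principle:
  fixes h :: "complex \<Rightarrow> real"
  assumes cont: "continuous_on (cball 0 r) h"
    and minor: "holomorphic_minorants_on h (ball 0 r)"
    and z: "z \<in> cball 0 r"
  obtains w where "cmod w = r" "h z \<le> h w"
proof -
  obtain b where b: "b \<in> cball 0 r" and hb: "\<And>y. y \<in> cball 0 r \<Longrightarrow> h y \<le> h b"
    using continuous_attains_sup[OF compact_cball _ cont] z by blast
  define K where "K = {y \<in> cball 0 r. h y = h b}"
  have "closed K"
    unfolding K_def using continuous_closed_preimage_constant[OF cont] by simp
  then have "compact K"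
    unfolding compact_eq_bounded_closed
    by (auto simp: K_def intro: bounded_subset[OF bounded_cball[of 0 r]])
  moreover have "b \<in> K"
    using b by (simp add: K_def)
  ultimately obtain a where a: "a \<in> K" and amax: "\<And>y. y \<in> K \<Longrightarrow> cmod y \<le> cmod a"
    using continuous_attains_sup[of K cmod] by (metis continuous_on_norm_id empty_iff)
  have "cmod a = r"
  proof (rule ccontr)
    assume "cmod a \<noteq> r"
    with a have "a \<in> ball 0 r"
      by (auto simp: K_def)
    then obtain e F where F: "e > 0" "F holomorphic_on ball a e" "ball a e \<subseteq> ball 0 r"
      "Re (F a) = h a" "\<And>y. y \<in> ball a e \<Longrightarrow> Re (F y) \<le> h y"
      by (rule holomorphic_minorants_onE[OF minor]) (rule that)
    have ball_cball: "y \<in> cball 0 r" if "y \<in> ball a e" for y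
      using F(3) that by force
    have "(\<lambda>y. exp (F y)) constant_on ball a e"
    proof (rule maximum_modulus_principle[where U = "ball a e" and \<xi> = a])
      show "(\<lambda>y. exp (F y)) holomorphic_on ball a e"
        using F(2) by (intro holomorphic_intros)
      fix y assume "y \<in> ball a e"
      then have "Re (F y) \<le> h b"
        using F(5) hb ball_cball by (meson order_trans)
      then show "cmod (exp (F y)) \<le> cmod (exp (F a))"
        using F(4) a by (simp add: K_def)
    qed (use F(1) in auto)
    then have const: "Re (F y) = h b" if "y \<in> ball a e" for y
    proof -
      have "exp (F y) = exp (F a)"
        using that \<open>(\<lambda>y. exp (F y)) constant_on ball a e\<close> \<open>e > 0\<close>
        unfolding constant_on_def by (metis centre_in_ball)
      then have "exp (Re (F y)) = exp (Re (F a))"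
        by (metis norm_exp_eq_Re)
      then show ?thesis
        using F(4) a by (simp add: K_def)
    qed
    \<comment> \<open>\<open>h\<close> lies between its minorant and its maximum, which now agree.\<close>
    have inK: "y \<in> K" if "y \<in> ball a e" for y
      using const[OF that] F(5)[OF that] hb ball_cball[OF that] by (fastforce simp: K_def)
    \<comment> \<open>The outward unit vector at \<open>a\<close>, any direction serving at the origin.\<close>
    define u where "u = (if a = 0 then 1 else sgn a)"
    define p where "p = a + of_real (e / 2) * u"
    have u: "cmod u = 1" "a = of_real (cmod a) * u"
      by (simp add: u_def norm_sgn) (simp add: u_def sgn_eq)
    have "p = of_real (cmod a + e / 2) * u"
      unfolding p_def by (subst u(2)) (simp add: algebra_simps)
    then have "cmod p = \<bar>cmod a + e / 2\<bar>"
      using u(1) by (metis norm_mult norm_of_real mult.right_neutral)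
    moreover have "p \<in> ball a e"
      using \<open>e > 0\<close> u(1) by (simp add: p_def dist_norm norm_mult)
    ultimately show False
      using amax[OF inK, of p] \<open>e > 0\<close> by simp
  qed
  moreover have "h z \<le> h a"
    using hb[OF z] a by (simp add: K_def)
  ultimately show thesis
    by (rule that)
qed

section \<open>Means over circles\<close>

lemma integral_eq_integral_sum_shifts:
  fixes g :: "real \<Rightarrow> real"
  assumes cont: "continuous_on UNIV g" and "d \<ge> 0"
  shows "integral {0..real n * d} g = integral {0..d} (\<lambda>t. \<Sum>k<n. g (t + real k * d))"
proof (induction n)
  case 0
  then show ?case by simp
next
  case (Suc n)
  have int: "f integrable_on {a..b}" if "continuous_on UNIV f" for f :: "real \<Rightarrow> real" and a b
    using that by (intro integrable_continuous_real) (auto elim: continuous_on_subset)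
  have shift: "continuous_on UNIV (\<lambda>t. g (t + c))" for c
    by (intro continuous_on_compose2[OF cont] continuous_intros) auto
  have "integral {0..real (Suc n) * d} g =
      integral {0..real n * d} g + integral {real n * d..real (Suc n) * d} g"
    using \<open>d \<ge> 0\<close> by (intro Henstock_Kurzweil_Integration.integral_combine[symmetric] int cont)
      (auto simp: algebra_simps)
  also have "integral {real n * d..real (Suc n) * d} g = integral {0..d} (\<lambda>t. g (t + real n * d))"
    using integral_shift_Icc_real[of 0 d g "real n * d"] by (simp add: o_def algebra_simps)
  also have "integral {0..real n * d} g + integral {0..d} (\<lambda>t. g (t + real n * d)) =
      integral {0..d} (\<lambda>t. \<Sum>k<Suc n. g (t + real k * d))"
    unfolding Suc.IH
    by (simp add: Henstock_Kurzweil_Integration.integral_add[symmetric] int shift continuous_on_sum)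
  finally show ?case .
qed

lemma sum_shifts_periodic:
  fixes g :: "real \<Rightarrow> real"
  assumes "\<And>t. g (t + real n * d) = g t"
  shows "(\<Sum>k<n. g (t + real m * d + real k * d)) = (\<Sum>k<n. g (t + real k * d))"
proof (induction m)
  case 0
  then show ?case by simp
next
  case (Suc m)
  let ?s = "t + real m * d"
  have "(\<Sum>k<n. g (t + real (Suc m) * d + real k * d)) = (\<Sum>k<n. g (?s + real (Suc k) * d))"
    by (simp add: algebra_simps)
  also have "\<dots> = (\<Sum>k<Suc n. g (?s + real k * d)) - g ?s"
    by (subst sum.lessThan_Suc_shift) simp
  also have "\<dots> = (\<Sum>k<n. g (?s + real k * d))"
    using assms[of ?s] by simp
  finally show ?case
    using Suc.IH by simp
qed

lemma continuous_on_circle: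
  assumes "continuous_on (cball 0 r) h" "0 \<le> s" "s \<le> r"
  shows "continuous_on A (\<lambda>t. h (of_real s * cis t))"
  using assms(2,3) by (intro continuous_on_compose2[OF assms(1)] continuous_intros)
    (auto simp: norm_mult)

text \<open>
  The sum of \<open>h\<close> over \<open>n\<close> equally spaced rotations again has holomorphic minorants, so
  on the inner circle it is bounded by its value at some point of the outer one.  There the sum
  is invariant under the rotation by \<open>d = 2\<pi>/n\<close>, so that point may be taken within an angle
  \<open>d\<close> of any other, which changes the sum by at most \<open>n * \<epsilon>\<close> once \<open>d\<close> is small.
  Integration over an arc of length \<open>d\<close> turns sums into integrals over the whole circle.
\<close>

lemma circle_integral_mono:
  fixes h :: "complex \<Rightarrow> real"
  assumes cont: "continuous_on (cball 0 r) h"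
    and minor: "holomorphic_minorants_on h (ball 0 r)"
    and \<rho>: "0 \<le> \<rho>" "\<rho> \<le> r" and "0 < r"
  shows "integral {0..2*pi} (\<lambda>t. h (of_real \<rho> * cis t))
       \<le> integral {0..2*pi} (\<lambda>t. h (of_real r * cis t))"
proof (rule field_le_epsilon)
  fix \<epsilon>' :: real assume "\<epsilon>' > 0"
  define \<epsilon> where "\<epsilon> = \<epsilon>' / (2 * pi)"
  have "\<epsilon> > 0"
    using \<open>\<epsilon>' > 0\<close> by (simp add: \<epsilon>_def)
  define g where "g = (\<lambda>s t. h (of_real s * cis t))"
  have contg: "continuous_on A (g s)" if "0 \<le> s" "s \<le> r" for s A
    unfolding g_def using continuous_on_circle[OF cont that] .
  have "uniformly_continuous_on {0..2*pi} (g r)"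
    using \<open>0 < r\<close> by (intro compact_uniformly_continuous contg) auto
  then obtain \<delta> where "\<delta> > 0"
    and \<delta>: "\<And>x y. \<lbrakk>x \<in> {0..2*pi}; y \<in> {0..2*pi}; \<bar>x - y\<bar> < \<delta>\<rbrakk> \<Longrightarrow> \<bar>g r x - g r y\<bar> < \<epsilon>"
    using \<open>\<epsilon> > 0\<close> unfolding uniformly_continuous_on_def dist_real_def by metis
  obtain n where n: "real n > 2 * pi / \<delta>"
    using reals_Archimedean2 by blast
  then have "n > 0"
    using \<open>\<delta> > 0\<close> by (cases n) (auto simp: divide_less_0_iff not_less)
  define d where "d = 2 * pi / real n"
  have nd: "real n * d = 2 * pi" and "d > 0" and "d < \<delta>"
    using \<open>n > 0\<close> n \<open>\<delta> > 0\<close> by (auto simp: d_def field_simps)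
  define m where "m = (\<lambda>s t. \<Sum>k<n. g s (t + real k * d))"
  define M where "M = (\<lambda>z. \<Sum>k<n. h (z * cis (real k * d)))"
  have M: "M (of_real s * cis t) = m s t" for s t
    by (simp add: M_def m_def g_def cis_mult[symmetric] mult.assoc)
  have contM: "continuous_on (cball 0 r) M"
    unfolding M_def
    by (intro continuous_intros continuous_on_compose2[OF cont]) (auto simp: norm_mult)
  have minorM: "holomorphic_minorants_on M (ball 0 r)"
    unfolding M_def
    by (intro holomorphic_minorants_on_sum holomorphic_minorants_on_rotate minor) auto
  have contm: "continuous_on A (m s)" if "0 \<le> s" "s \<le> r" for s A
    unfolding m_def
    by (intro continuous_intros continuous_on_compose2[OF contg[OF that, of UNIV]]) auto
  have le: "m \<rho> t \<le> m r t + real n * \<epsilon>" if t: "t \<in> {0..d}" for t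
  proof -
    have "of_real \<rho> * cis t \<in> cball 0 r"
      using \<rho> by (simp add: norm_mult)
    then obtain w where w: "cmod w = r" "M (of_real \<rho> * cis t) \<le> M w"
      using holomorphic_minorants_maximum_principle[OF contM minorM] by blast
    define s where "s = Arg2pi w"
    have "w = of_real r * cis s" "0 \<le> s"
      using Arg2pi[of w] w(1) by (auto simp: s_def is_Arg_def cis_conv_exp)
    then have "m \<rho> t \<le> m r s"
      using w(2) M by metis
    \<comment> \<open>Rotate back by a multiple of \<open>d\<close> into the arc \<open>{0..d}\<close> that contains \<open>t\<close>.\<close>
    define j where "j = nat \<lfloor>s / d\<rfloor>"
    define \<tau> where "\<tau> = s - real j * d"
    have "real j = of_int \<lfloor>s / d\<rfloor>"
      using \<open>0 \<le> s\<close> \<open>d > 0\<close> by (simp add: j_def)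
    moreover have "of_int \<lfloor>s / d\<rfloor> \<le> s / d" "s / d < of_int \<lfloor>s / d\<rfloor> + 1"
      by linarith+
    ultimately have "real j \<le> s / d" "s / d < real j + 1"
      by simp_all
    then have \<tau>: "0 \<le> \<tau>" "\<tau> \<le> d"
      using \<open>d > 0\<close> by (auto simp: \<tau>_def field_simps)
    have "m r s = m r \<tau>"
    proof -
      have "g r (x + real n * d) = g r x" for x
        unfolding g_def nd by (simp flip: cis_mult)
      from sum_shifts_periodic[of "g r" n d \<tau> j, OF this] show ?thesis
        by (simp add: m_def \<tau>_def)
    qed
    also have "\<dots> \<le> (\<Sum>k<n. g r (t + real k * d) + \<epsilon>)"
      unfolding m_def
    proof (rule sum_mono)
      fix k assume k: "k \<in> {..<n}"
      have kd: "(real k + 1) * d \<le> 2 * pi"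
        using k \<open>d > 0\<close> unfolding nd[symmetric] by (intro mult_right_mono) auto
      \<comment> \<open>All sample points stay in the compact interval of uniform continuity.\<close>
      have range: "x + real k * d \<in> {0..2*pi}" if "0 \<le> x" "x \<le> d" for x
        using kd that \<open>d > 0\<close> by (auto simp: algebra_simps)
      have "\<bar>(\<tau> + real k * d) - (t + real k * d)\<bar> < \<delta>"
        using \<tau> t \<open>d < \<delta>\<close> by auto
      then have "\<bar>g r (\<tau> + real k * d) - g r (t + real k * d)\<bar> < \<epsilon>"
        using t \<tau> by (intro \<delta> range) auto
      then show "g r (\<tau> + real k * d) \<le> g r (t + real k * d) + \<epsilon>"
        by linarith
    qed
    also have "\<dots> = m r t + real n * \<epsilon>"
      by (simp add: m_def sum.distrib)
    finally show ?thesis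
      using \<open>m \<rho> t \<le> m r s\<close> by linarith
  qed
  have shifts: "integral {0..2*pi} (g s) = integral {0..d} (m s)" if "0 \<le> s" "s \<le> r" for s
    using integral_eq_integral_sum_shifts[OF contg[OF that], of d n] \<open>d > 0\<close>
    by (simp add: nd m_def)
  have int: "m s integrable_on {0..d}" if "0 \<le> s" "s \<le> r" for s
    using integrable_continuous_real contm[OF that] by blast
  have "integral {0..2*pi} (g \<rho>) = integral {0..d} (m \<rho>)"
    using shifts \<rho> by blast
  also have "\<dots> \<le> integral {0..d} (\<lambda>t. m r t + real n * \<epsilon>)"
    using \<rho> le \<open>0 < r\<close> by (intro integral_le int integrable_add) auto
  also have "\<dots> = integral {0..d} (m r) + real n * d * \<epsilon>"
    using \<open>0 < r\<close> \<open>d > 0\<close>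
    by (subst Henstock_Kurzweil_Integration.integral_add) (auto intro!: int)
  also have "\<dots> = integral {0..2*pi} (g r) + \<epsilon>'"
    using shifts[of r] \<open>0 < r\<close> unfolding nd by (simp add: \<epsilon>_def)
  finally show "integral {0..2*pi} (\<lambda>t. h (of_real \<rho> * cis t))
       \<le> integral {0..2*pi} (\<lambda>t. h (of_real r * cis t)) + \<epsilon>'"
    unfolding g_def .
qed

text \<open>
  The circle integrals of \<open>h\<close> are nonnegative and increase with the radius, but dominated
  convergence makes them tend to \<open>0\<close> at the boundary; so they all vanish.
\<close>

lemma holomorphic_minorants_eq_0:
  fixes h :: "complex \<Rightarrow> real"
  assumes cont: "continuous_on unit_disc h"
    and minor: "holomorphic_minorants_on h unit_disc"
    and nonneg: "\<And>z. z \<in> unit_disc \<Longrightarrow> 0 \<le> h z"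
    and bound: "\<And>z. z \<in> unit_disc \<Longrightarrow> h z \<le> B"
    and radial: "AE t in lebesgue_on {0..2*pi}.
        ((\<lambda>r. h (of_real r * cis t)) \<longlongrightarrow> 0) (at_left (1::real))"
    and z: "z \<in> unit_disc"
  shows "h z = 0"
proof -
  define I where "I = (\<lambda>r. integral {0..2*pi} (\<lambda>t. h (of_real r * cis t)))"
  have contc: "continuous_on (cball 0 r) h" if "r < 1" for r
    using cont that by (auto elim!: continuous_on_subset)
  have contt: "continuous_on {0..2*pi} (\<lambda>t. h (of_real r * cis t))" if "0 \<le> r" "r < 1" for r
    using continuous_on_circle[OF contc] that by blast
  define R where "R = (\<lambda>n. 1 - 1 / real (n + 2))"
  have R: "0 < R n" "R n < 1" for n
    by (auto simp: R_def field_simps)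
  have R_lim: "R \<longlonglongrightarrow> 1"
    unfolding R_def by real_asymp
  have R_left: "filterlim R (at_left 1) sequentially"
    using R_lim R(2) by (auto simp: filterlim_at less_imp_neq)
  have "(\<lambda>n. integral\<^sup>L (lebesgue_on {0..2*pi}) (\<lambda>t. h (of_real (R n) * cis t)))
      \<longlonglongrightarrow> integral\<^sup>L (lebesgue_on {0..2*pi}) (\<lambda>t. 0)"
  proof (rule integral_dominated_convergence[where w = "\<lambda>_. B"])
    show "(\<lambda>t. h (of_real (R n) * cis t)) \<in> borel_measurable (lebesgue_on {0..2*pi})" for n
      using continuous_imp_integrable_real[OF contt] R by (meson borel_measurable_integrable less_imp_le)
    show "integrable (lebesgue_on {0..2*pi}) (\<lambda>_. B)"
      by (intro continuous_imp_integrable_real continuous_intros)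
    show "AE t in lebesgue_on {0..2*pi}. (\<lambda>n. h (of_real (R n) * cis t)) \<longlonglongrightarrow> 0"
      using radial by eventually_elim (rule filterlim_compose[OF _ R_left])
    show "AE t in lebesgue_on {0..2*pi}. norm (h (of_real (R n) * cis t)) \<le> B" for n
    proof (rule AE_I2)
      fix t
      have "of_real (R n) * cis t \<in> unit_disc"
        using R[of n] by (simp add: norm_mult)
      then show "norm (h (of_real (R n) * cis t)) \<le> B"
        using nonneg bound by simp
    qed
  qed auto
  then have I_lim: "(\<lambda>n. I (R n)) \<longlonglongrightarrow> 0"
    unfolding I_def using continuous_imp_integrable_real[OF contt] R
    by (simp add: lebesgue_integral_eq_integral less_imp_le)
  define \<rho> where "\<rho> = cmod z"
  have \<rho>: "0 \<le> \<rho>" "\<rho> < 1"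
    using z by (auto simp: \<rho>_def)
  have circle: "0 \<le> h (of_real \<rho> * cis t)" for t
    using \<rho> by (intro nonneg) (simp add: norm_mult)
  have "I \<rho> \<le> 0"
  proof (rule tendsto_lowerbound[OF I_lim])
    have "eventually (\<lambda>n. \<rho> < R n) sequentially"
      using R_lim \<rho>(2) by (rule order_tendstoD)
    then show "eventually (\<lambda>n. I \<rho> \<le> I (R n)) sequentially"
    proof eventually_elim
      case (elim n)
      have "holomorphic_minorants_on h (ball 0 (R n))"
        using R[of n] by (intro holomorphic_minorants_on_open_subset[OF minor]) auto
      then show ?case
        unfolding I_def using \<rho> elim R[of n]
        by (intro circle_integral_mono contc) auto
    qed
  qed simp
  moreover have "I \<rho> \<ge> 0"
    unfolding I_def using circle integrable_continuous_real[OF contt[OF \<rho>]]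
    by (intro Henstock_Kurzweil_Integration.integral_nonneg) auto
  ultimately have "\<forall>t\<in>{0..2*pi}. h (of_real \<rho> * cis t) = 0"
    using integral_eq_0_iff[OF contt[OF \<rho>]] circle by (simp add: I_def)
  moreover have "z = of_real \<rho> * cis (Arg2pi z)" "Arg2pi z \<in> {0..2*pi}"
    using Arg2pi[of z] by (auto simp: \<rho>_def is_Arg_def cis_conv_exp)
  ultimately show ?thesis
    by metis
qed

section \<open>Components of level sets\<close>

text \<open>
  On a component \<open>C\<close> with \<open>\<bar>v\<bar> \<ge> \<delta>\<close> the function \<open>1 / \<bar>v\<bar> - 1 / \<eta>\<close> is bounded, positive, and
  zero on the part of the boundary of \<open>C\<close> that lies in the disc.  Extended by \<open>0\<close> it is
  subharmonic on the disc, and its radial limits vanish almost everywhere because those of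
  \<open>v\<close> are unimodular.  So it vanishes identically, whereas it is positive on \<open>C\<close>.
\<close>

lemma component_level_set_deep:
  assumes v: "inner_function v" and "0 < \<delta>" "0 < \<eta>" "\<eta> < 1"
    and C: "C \<in> components (level_set v \<eta>)"
  obtains z where "z \<in> C" "cmod (v z) < \<delta>"
proof (rule ccontr)
  note deep = that
  assume "\<not> thesis"
  then have \<delta>: "cmod (v z) \<ge> \<delta>" if "z \<in> C" for z
    using \<open>\<not> thesis\<close> deep[OF that] by linarith
  have hol: "v holomorphic_on unit_disc"
    using v by (simp add: inner_function_def)
  then have contv: "continuous_on unit_disc v"
    by (rule holomorphic_on_imp_continuous_on)
  have C_sub: "C \<subseteq> level_set v \<eta>"
    using C by (rule in_components_subset)
  then have C_disc: "C \<subseteq> unit_disc"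
    by (auto simp: level_set_def)
  have "open (level_set v \<eta>)"
  proof -
    have "level_set v \<eta> = unit_disc \<inter> (\<lambda>z. cmod (v z)) -` {..<\<eta>}"
      by (auto simp: level_set_def)
    then show ?thesis
      using contv by (metis continuous_on_norm continuous_open_preimage open_ball open_lessThan)
  qed
  then have "open C"
    using C open_components by blast
  \<comment> \<open>The closure of \<open>C\<close> relative to the disc.\<close>
  define S where "S = unit_disc \<inter> closure C"
  have "C \<subseteq> S"
    using C_disc closure_subset by (auto simp: S_def)
  have closure_in: "S \<inter> A \<subseteq> B" if "C \<subseteq> B" "closedin (top_of_set A) B" for A B :: "complex set"
  proof -
    obtain T where "closed T" "B = A \<inter> T"
      using \<open>closedin (top_of_set A) B\<close> by (auto simp: closedin_closed)
    moreover from this have "closure C \<subseteq> T"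
      using \<open>C \<subseteq> B\<close> by (intro closure_minimal) auto
    ultimately show ?thesis
      by (auto simp: S_def)
  qed
  have S_\<delta>: "\<delta> \<le> cmod (v z)" if "z \<in> S" for z
  proof -
    have "closedin (top_of_set unit_disc) {z \<in> unit_disc. \<delta> \<le> cmod (v z)}"
      using continuous_closedin_preimage[OF continuous_on_norm[OF contv], of "{\<delta>..}"]
      by (simp add: vimage_def Int_def)
    then have "S \<inter> unit_disc \<subseteq> {z \<in> unit_disc. \<delta> \<le> cmod (v z)}"
      using \<delta> C_disc by (intro closure_in) auto
    then show ?thesis
      using that by (auto simp: S_def)
  qed
  have S_\<eta>: "cmod (v z) = \<eta>" if z: "z \<in> S" "z \<notin> C" for z
  proof (rule antisym)
    have "closedin (top_of_set unit_disc) {z \<in> unit_disc. cmod (v z) \<le> \<eta>}"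
      using continuous_closedin_preimage[OF continuous_on_norm[OF contv], of "{..\<eta>}"]
      by (simp add: vimage_def Int_def)
    then have "S \<inter> unit_disc \<subseteq> {z \<in> unit_disc. cmod (v z) \<le> \<eta>}"
      using C_sub by (intro closure_in) (auto simp: level_set_def less_imp_le)
    then show "cmod (v z) \<le> \<eta>"
      using z by (auto simp: S_def)
    \<comment> \<open>A component is relatively closed, so no boundary point of \<open>C\<close> is in the level set.\<close>
    have "S \<inter> level_set v \<eta> \<subseteq> C"
      using closedin_component[OF C] by (intro closure_in) auto
    then show "\<eta> \<le> cmod (v z)"
      using z by (force simp: S_def level_set_def)
  qed
  define h where "h = (\<lambda>z. if z \<in> C then 1 / cmod (v z) - 1 / \<eta> else 0)"
  have nonneg: "0 \<le> h z" for z
  proof (cases "z \<in> C")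
    case True
    then have "cmod (v z) \<le> \<eta>" "0 < cmod (v z)"
      using C_sub \<delta>[OF True] \<open>0 < \<delta>\<close> by (auto simp: level_set_def less_imp_le)
    then show ?thesis
      using True by (simp add: h_def frac_le)
  qed (simp add: h_def)
  have "h z = 0" if "z \<in> unit_disc" for z
  proof (rule holomorphic_minorants_eq_0[OF _ _ nonneg _ _ that])
    show "continuous_on unit_disc h"
    proof -
      have union: "S \<union> (unit_disc - C) = unit_disc"
        using \<open>C \<subseteq> S\<close> by (auto simp: S_def)
      have "continuous_on (S \<union> (unit_disc - C)) h"
        unfolding h_def
      proof (rule continuous_on_cases_local)
        show "closedin (top_of_set (S \<union> (unit_disc - C))) S"
          unfolding union by (auto simp: S_def intro: closedin_closed_Int)
        show "closedin (top_of_set (S \<union> (unit_disc - C))) (unit_disc - C)"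
          unfolding union using \<open>open C\<close> by (auto simp: Diff_eq intro: closedin_closed_Int)
        have "continuous_on S v"
          using contv by (rule continuous_on_subset) (auto simp: S_def)
        then show "continuous_on S (\<lambda>z. 1 / cmod (v z) - 1 / \<eta>)"
          using S_\<delta> \<open>0 < \<delta>\<close> by (intro continuous_intros) fastforce+
      qed (use S_\<eta> in \<open>auto simp: S_def\<close>)
      then show ?thesis
        by (simp add: union)
    qed
    show "holomorphic_minorants_on h unit_disc"
      unfolding holomorphic_minorants_on_def
    proof
      fix a assume a: "a \<in> unit_disc"
      show "\<exists>e>0. \<exists>F. F holomorphic_on ball a e \<and> ball a e \<subseteq> unit_disc \<and>
          Re (F a) = h a \<and> (\<forall>z\<in>ball a e. Re (F z) \<le> h z)"
      proof (cases "a \<in> C")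
        case True
        obtain e where e: "e > 0" "ball a e \<subseteq> C"
          using True \<open>open C\<close> openE by blast
        have nz: "v z \<noteq> 0" if "z \<in> ball a e" for z
          using that e(2) \<delta>[of z] \<open>0 < \<delta>\<close> by auto
        \<comment> \<open>The unimodular factor makes the quotient real and positive at \<open>a\<close>.\<close>
        define F where "F = (\<lambda>z. sgn (v a) / v z - of_real (1 / \<eta>))"
        have sgn: "cmod (sgn (v a)) = 1"
          using nz[of a] e(1) by (simp add: norm_sgn)
        have "v holomorphic_on ball a e"
          using hol by (rule holomorphic_on_subset) (use e(2) C_disc in auto)
        then have "F holomorphic_on ball a e"
          unfolding F_def using nz by (intro holomorphic_intros)
        moreover have "Re (F a) = h a"
          using True nz[of a] e(1)
          by (simp add: F_def h_def sgn_eq flip: of_real_divide)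
        moreover have "Re (F z) \<le> h z" if "z \<in> ball a e" for z
        proof -
          have "Re (sgn (v a) / v z) \<le> cmod (sgn (v a) / v z)"
            by (rule complex_Re_le_cmod)
          also have "\<dots> = 1 / cmod (v z)"
            using sgn by (simp add: norm_divide)
          finally show ?thesis
            using that e(2) by (auto simp: F_def h_def simp flip: of_real_divide)
        qed
        ultimately show ?thesis
          using e C_disc by blast
      next
        case False
        \<comment> \<open>Here \<open>h\<close> takes its minimum \<open>0\<close>, so the zero function is a minorant.\<close>
        obtain e where "e > 0" "ball a e \<subseteq> unit_disc"
          using a openE open_ball by blast
        then show ?thesis
          using False nonneg by (intro exI[of _ e] conjI exI[of _ "\<lambda>_. 0"]) (auto simp: h_def)
      qed
    qed
    show "h z \<le> 1 / \<delta>" for z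
    proof (cases "z \<in> C")
      case True
      then have "1 / cmod (v z) \<le> 1 / \<delta>"
        using \<delta> \<open>0 < \<delta>\<close> by (simp add: frac_le)
      moreover have "0 < 1 / \<eta>"
        using \<open>0 < \<eta>\<close> by simp
      moreover have "h z = 1 / cmod (v z) - 1 / \<eta>"
        using True by (simp add: h_def)
      ultimately show ?thesis
        by linarith
    qed (use \<open>0 < \<delta>\<close> in \<open>simp add: h_def\<close>)
    have "AE t in lebesgue_on {0..2*pi}.
        \<exists>l. ((\<lambda>r. v (of_real r * cis t)) \<longlongrightarrow> l) (at_left (1::real)) \<and> cmod l = 1"
      using v by (simp add: inner_function_def)
    then show "AE t in lebesgue_on {0..2*pi}.
        ((\<lambda>r. h (of_real r * cis t)) \<longlongrightarrow> 0) (at_left (1::real))"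
    proof eventually_elim
      case (elim t)
      then have "((\<lambda>r. cmod (v (of_real r * cis t))) \<longlongrightarrow> 1) (at_left (1::real))"
        by (metis tendsto_norm)
      then have "eventually (\<lambda>r. \<eta> < cmod (v (of_real r * cis t))) (at_left (1::real))"
        using \<open>\<eta> < 1\<close> by (rule order_tendstoD)
      \<comment> \<open>Almost every radius finally leaves the level set, so \<open>h\<close> is \<open>0\<close> near its end.\<close>
      then have "eventually (\<lambda>r. h (of_real r * cis t) = 0) (at_left (1::real))"
        by eventually_elim (use C_sub in \<open>auto simp: h_def level_set_def\<close>)
      then show ?case
        by (rule tendsto_eventually)
    qed
  qed
  moreover obtain z where "z \<in> C"
    using C in_components_nonempty by blast
  ultimately have "1 / cmod (v z) = 1 / \<eta>"
    using C_disc by (force simp: h_def)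
  then have "cmod (v z) = \<eta>"
    by (metis divide_divide_eq_right div_by_1 mult_1)
  moreover have "cmod (v z) < \<eta>"
    using \<open>z \<in> C\<close> C_sub by (auto simp: level_set_def)
  ultimately show False
    by simp
qed

section \<open>Perturbation of inner functions\<close>

text \<open>
  A component of \<open>{\<bar>v\<bar> < \<eta> + \<epsilon>}\<close> contains a point with \<open>\<bar>v\<bar> < \<eta> - \<epsilon>\<close>, hence with \<open>\<bar>u\<bar> < \<eta>\<close>.  Any two
  components are therefore joined through the connected set \<open>{\<bar>u\<bar> < \<eta>}\<close>.
\<close>

lemma connected_level_set_perturb:
  assumes conn: "connected (level_set u \<eta>)" and v: "inner_function v"
    and \<epsilon>: "0 < \<epsilon>" "\<epsilon> < \<eta>" "\<eta> + \<epsilon> < 1"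
    and close: "\<And>z. z \<in> unit_disc \<Longrightarrow> cmod (u z - v z) < \<epsilon>"
  shows "connected (level_set v (\<eta> + \<epsilon>))"
proof -
  let ?L = "level_set v (\<eta> + \<epsilon>)"
  have close': "\<bar>cmod (u z) - cmod (v z)\<bar> < \<epsilon>" if "z \<in> unit_disc" for z
    using close[OF that] norm_triangle_ineq3[of "u z" "v z"] by linarith
  have sub: "level_set u \<eta> \<subseteq> ?L"
    using close' by (fastforce simp: level_set_def)
  have meets: "\<exists>p \<in> level_set u \<eta>. connected_component ?L x p" if x: "x \<in> ?L" for x
  proof -
    have C: "connected_component_set ?L x \<in> components ?L"
      using x by (rule componentsI)
    obtain p where p: "p \<in> connected_component_set ?L x" "cmod (v p) < \<eta> - \<epsilon>"
      using component_level_set_deep[OF v _ _ _ C, of "\<eta> - \<epsilon>"] \<epsilon> by auto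
    then have "p \<in> unit_disc"
      using connected_component_in[of ?L x p] by (auto simp: level_set_def)
    then have "p \<in> level_set u \<eta>"
      using p(2) close'[of p] by (auto simp: level_set_def)
    then show ?thesis
      using p(1) by auto
  qed
  show ?thesis
    unfolding connected_iff_connected_component
  proof (intro ballI)
    fix x y assume "x \<in> ?L" "y \<in> ?L"
    then obtain p q where pq: "p \<in> level_set u \<eta>" "connected_component ?L x p"
      "q \<in> level_set u \<eta>" "connected_component ?L y q"
      using meets by blast
    have "connected_component ?L p q"
      using conn sub pq unfolding connected_component_def by blast
    then show "connected_component ?L x y"
      using pq by (meson connected_component_sym connected_component_trans)
  qed
qed

theorem theorem2p10:
  shows "openin (subtopology (mtopology_of bounded_functions) inner_functions)
           one_component_inner_functions"
proof (subst openin_subopen, rule ballI)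
  fix u assume "u \<in> one_component_inner_functions"
  then obtain \<eta> where u: "u \<in> inner_functions" and \<eta>: "0 < \<eta>" "\<eta> < 1" "connected (level_set u \<eta>)"
    by (auto simp: one_component_inner_functions_def one_component_def)
  define \<epsilon> where "\<epsilon> = min \<eta> (1 - \<eta>) / 2"
  have \<epsilon>: "0 < \<epsilon>" "\<epsilon> < \<eta>" "\<eta> + \<epsilon> < 1"
    using \<eta> by (auto simp: \<epsilon>_def min_def field_simps)
  let ?B = "mball_of bounded_functions u \<epsilon>"
  have "openin (mtopology_of bounded_functions) ?B"
    unfolding mtopology_of_def mball_of_def
    by (rule Metric_space.openin_mball[OF Metric_space_mspace_mdist])
  then have "openin (subtopology (mtopology_of bounded_functions) inner_functions)
      (?B \<inter> inner_functions)"
    by (auto simp: openin_subtopology)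
  moreover have "u \<in> ?B \<inter> inner_functions"
  proof -
    have "u \<in> mspace bounded_functions"
      using u inner_functions_subset by blast
    moreover from this have "mdist bounded_functions u u = 0"
      by (rule Metric_space.mdist_zero[OF Metric_space_mspace_mdist])
    ultimately show ?thesis
      using u \<epsilon>(1) by (simp only: in_mball_of Int_iff)
  qed
  moreover have "?B \<inter> inner_functions \<subseteq> one_component_inner_functions"
  proof
    fix v assume v: "v \<in> ?B \<inter> inner_functions"
    then have uv: "u \<in> mspace bounded_functions" "v \<in> mspace bounded_functions"
      "mdist bounded_functions u v < \<epsilon>"
      by simp_all
    have "cmod (u z - v z) < \<epsilon>" if "z \<in> unit_disc" for z
    proof -
      have "bdd_above ((\<lambda>z. cmod (u z - v z)) ` unit_disc)"
      proof -
        obtain A B where "\<forall>z\<in>unit_disc. cmod (u z) \<le> A" "\<forall>z\<in>unit_disc. cmod (v z) \<le> B"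
          using uv(1,2) unfolding mspace_bounded_functions bounded_iff by auto
        then have "cmod (u z - v z) \<le> A + B" if "z \<in> unit_disc" for z
          using that norm_triangle_ineq4[of "u z" "v z"] by fastforce
        then show ?thesis
          by (rule bdd_aboveI2)
      qed
      then have "cmod (u z - v z) \<le> mdist bounded_functions u v"
        unfolding mdist_bounded_functions[OF uv(1,2)] using that by (rule cSUP_upper2) simp
      then show ?thesis
        using uv(3) by linarith
    qed
    then have "connected (level_set v (\<eta> + \<epsilon>))"
      using v \<eta> \<epsilon> by (intro connected_level_set_perturb[of u]) (auto simp: inner_functions_def)
    then have "one_component v"
      using \<eta> \<epsilon> unfolding one_component_def by (intro exI[of _ "\<eta> + \<epsilon>"]) auto
    then show "v \<in> one_component_inner_functions"
      using v by (simp add: one_component_inner_functions_def)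
  qed
  ultimately show "\<exists>T. openin (subtopology (mtopology_of bounded_functions) inner_functions) T \<and>
      u \<in> T \<and> T \<subseteq> one_component_inner_functions"
    by blast
qed

end
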